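(* Let $\Omega=(0,1)^2\subset\mathbb R^2$, let $f\in L^2(\Omega)$ with $f>0$ almost everywhere, and let $\varphi$ be prescribed Dirichlet data on $\partial\Omega$. Consider $$J(u):=\frac12\int_\Omega\bigl(\det D^2u-f\bigr)^2\,dx.$$ Let $\bar u\in C^3(\overline\Omega)$ satisfy $\bar u=\varphi$ on $\partial\Omega$ and be uniformly convex, i.e. there are constants $0<\lambda\le\Lambda<\infty$ with $\lambda I\le D^2\bar u(x)\le\Lambda I$ for all $x\in\overline\Omega$. If $\bar u$ is a critical point of $J$, i.e. $$DJ(\bar u)[v]=0\qquad\text{for every }v\in C^2(\overline\Omega)\text{ with }v=0\text{ on }\partial\Omega,$$ then $\det D^2\bar u=f$ almost everywhere in $\Omega$. That is, every uniformly convex critical point of class $C^3(\overline\Omega)$ solves the Monge--Amp\`ere equation.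
   Context: $DJ(\bar u)[v]=\int_\Omega(\det D^2\bar u-f)\,\operatorname{cof}(D^2\bar u):D^2v\,dx$ is the first variation of $J$ at $\bar u$ in the direction $v$, where $\operatorname{cof}$ denotes the cofactor matrix and $A:B=\sum_{i,j}A_{ij}B_{ij}$. Trial functions range over $C^2(\overline\Omega)$ functions with boundary trace $\varphi$, and admissible variations over $C^2(\overline\Omega)$ functions vanishing on $\partial\Omega$. *)

theory Defs
  imports "HOL-Analysis.Analysis"
begin

section \<open>Functions of class C^k up to the boundary\<close>

text \<open>
  Derivatives are taken within \<open>S\<close>, so for \<open>S\<close> the closure of a convex open set \<open>\<Omega>\<close> they are the
  ordinary derivatives in \<open>\<Omega>\<close> and one-sided on the boundary, where they are still unique. On such
  \<open>S\<close>, \<open>Ck k S u\<close> says exactly that all partial derivatives of \<open>u\<close> of order at most \<open>k\<close> exist in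
  \<open>\<Omega>\<close> and extend continuously to \<open>S\<close>; the boundary values of the derivatives are those extensions.
\<close>

definition partial :: "(real^'n) set \<Rightarrow> 'n::finite \<Rightarrow> (real^'n \<Rightarrow> real) \<Rightarrow> real^'n \<Rightarrow> real" where
  "partial S i u x = frechet_derivative u (at x within S) (axis i 1)"

primrec Ck :: "nat \<Rightarrow> (real^'n::finite) set \<Rightarrow> (real^'n \<Rightarrow> real) \<Rightarrow> bool" where
  "Ck 0 S u \<longleftrightarrow> continuous_on S u"
| "Ck (Suc k) S u \<longleftrightarrow> u differentiable_on S \<and> (\<forall>i. Ck k S (partial S i u))"

definition hessian :: "(real^'n) set \<Rightarrow> (real^'n::finite \<Rightarrow> real) \<Rightarrow> real^'n \<Rightarrow> real^'n^'n" where
  "hessian S u x = (\<chi> i j. partial S i (partial S j u) x)"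

text \<open>The order \<open>A \<le> B\<close> of quadratic forms, meant for symmetric matrices.\<close>

definition loewner_le :: "real^'n^'n \<Rightarrow> real^'n^'n::finite \<Rightarrow> bool" where
  "loewner_le A B \<longleftrightarrow> (\<forall>\<xi>. \<xi> \<bullet> (A *v \<xi>) \<le> \<xi> \<bullet> (B *v \<xi>))"

definition uniformly_convex_on :: "(real^'n::finite) set \<Rightarrow> (real^'n \<Rightarrow> real) \<Rightarrow> bool" where
  "uniformly_convex_on S u \<longleftrightarrow>
     (\<exists>l L. 0 < l \<and> l \<le> L \<and>
        (\<forall>x\<in>S. loewner_le (mat l) (hessian S u x) \<and> loewner_le (hessian S u x) (mat L)))"

definition cofactor_matrix :: "real^2^2 \<Rightarrow> real^2^2" where
  "cofactor_matrix A = vector [vector [A$2$2, - A$2$1], vector [- A$1$2, A$1$1]]"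

definition square_integrable :: "'a measure \<Rightarrow> ('a \<Rightarrow> real) \<Rightarrow> bool" where
  "square_integrable M f \<longleftrightarrow> f \<in> borel_measurable M \<and> integrable M (\<lambda>x. (f x)\<^sup>2)"


section \<open>The least-squares functional of the Monge--Ampere equation\<close>

definition unit_square :: "(real^2) set" where
  "unit_square = {x. \<forall>i. 0 < x $ i \<and> x $ i < 1}"

abbreviation D2 :: "(real^2 \<Rightarrow> real) \<Rightarrow> real^2 \<Rightarrow> real^2^2" where
  "D2 u \<equiv> hessian (closure unit_square) u"

definition J :: "(real^2 \<Rightarrow> real) \<Rightarrow> (real^2 \<Rightarrow> real) \<Rightarrow> real" where
  "J f u = 1/2 * (LINT x|lebesgue_on unit_square. (det (D2 u x) - f x)\<^sup>2)"

text \<open>On \<open>real^2^2\<close>, \<open>\<bullet>\<close> is the Frobenius product \<open>A : B\<close>; see \<open>frobenius\<close> below.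
  That \<open>DJ\<close> is the first variation of \<open>J\<close> is \<open>J_has_first_variation\<close> below.\<close>

definition DJ :: "(real^2 \<Rightarrow> real) \<Rightarrow> (real^2 \<Rightarrow> real) \<Rightarrow> (real^2 \<Rightarrow> real) \<Rightarrow> real" where
  "DJ f u v =
     (LINT x|lebesgue_on unit_square.
        (det (D2 u x) - f x) * (cofactor_matrix (D2 u x) \<bullet> D2 v x))"

definition trial :: "(real^2 \<Rightarrow> real) \<Rightarrow> (real^2 \<Rightarrow> real) \<Rightarrow> bool" where
  "trial \<phi> u \<longleftrightarrow> Ck 2 (closure unit_square) u \<and> (\<forall>x\<in>frontier unit_square. u x = \<phi> x)"

definition critical_point :: "(real^2 \<Rightarrow> real) \<Rightarrow> (real^2 \<Rightarrow> real) \<Rightarrow> (real^2 \<Rightarrow> real) \<Rightarrow> bool" where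
  "critical_point f \<phi> u \<longleftrightarrow>
     trial \<phi> u \<and>
     (\<forall>v. Ck 2 (closure unit_square) v \<and> (\<forall>x\<in>frontier unit_square. v x = 0) \<longrightarrow> DJ f u v = 0)"


section \<open>The first variation\<close>

lemma frobenius: "(A :: real^'n^'m) \<bullet> B = (\<Sum>i\<in>UNIV. \<Sum>j\<in>UNIV. A$i$j * B$i$j)"
  by (simp add: inner_vec_def)

lemma unit_square_box: "unit_square = box 0 (\<chi> i. 1)"
  by (auto simp: unit_square_def mem_box_cart)

lemma closure_unit_square: "closure unit_square = cbox 0 (\<chi> i. 1)"
proof -
  have "(\<chi> i. 1/2) \<in> box (0 :: real^2) (\<chi> i. 1)" by (simp add: mem_box_cart)
  then show ?thesis unfolding unit_square_box by (metis closure_box empty_iff)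
qed

lemma partial_eq:
  assumes "(u has_derivative u') (at x within closure unit_square)" "x \<in> closure unit_square"
  shows "partial (closure unit_square) i u x = u' (axis i 1)"
proof -
  have "frechet_derivative u (at x within closure unit_square) = u'"
    using assms unfolding closure_unit_square
    by (intro frechet_derivative_within_cbox) (auto simp: Basis_vec_def inner_axis)
  then show ?thesis by (simp add: partial_def)
qed

lemma partial_add_scaled:
  assumes "u differentiable_on closure unit_square" "v differentiable_on closure unit_square"
    and x: "x \<in> closure unit_square"
    and w: "\<And>y. y \<in> closure unit_square \<Longrightarrow> w y = u y + t * v y"
  shows "partial (closure unit_square) i w x =
           partial (closure unit_square) i u x + t * partial (closure unit_square) i v x"
proof -
  obtain u' v' where u': "(u has_derivative u') (at x within closure unit_square)"
    and v': "(v has_derivative v') (at x within closure unit_square)"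
    using assms(1-3) unfolding differentiable_on_def differentiable_def by blast
  have "((\<lambda>y. u y + t * v y) has_derivative (\<lambda>h. u' h + t * v' h)) (at x within closure unit_square)"
    using u' v' by (auto intro!: derivative_eq_intros)
  then have w': "(w has_derivative (\<lambda>h. u' h + t * v' h)) (at x within closure unit_square)"
    by (rule has_derivative_transform[OF x w, rotated])
  show ?thesis by (simp only: partial_eq[OF u' x] partial_eq[OF v' x] partial_eq[OF w' x])
qed

lemma D2_add_scaled:
  assumes "Ck 2 (closure unit_square) u" "Ck 2 (closure unit_square) v"
    and x: "x \<in> closure unit_square"
  shows "D2 (\<lambda>y. u y + t * v y) x = D2 u x + t *\<^sub>R D2 v x"
proof -
  note * = assms(1,2)[unfolded numeral_2_eq_2 Ck.simps]
  have "partial (closure unit_square) i (partial (closure unit_square) j (\<lambda>y. u y + t * v y)) x =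
     partial (closure unit_square) i (partial (closure unit_square) j u) x +
     t * partial (closure unit_square) i (partial (closure unit_square) j v) x" for i j
    using * x by (intro partial_add_scaled) auto
  then show ?thesis by (simp add: hessian_def vec_eq_iff)
qed

lemma det_add_scaled:
  fixes A B :: "real^2^2"
  shows "det (A + t *\<^sub>R B) = det A + t * (cofactor_matrix A \<bullet> B) + t\<^sup>2 * det B"
  by (simp add: det_2 frobenius sum_2 cofactor_matrix_def power2_eq_square algebra_simps)

lemma continuous_on_D2:
  assumes "Ck 2 (closure unit_square) u"
  shows "continuous_on (closure unit_square) (\<lambda>x. D2 u x $ i $ j)"
  using assms by (simp add: numeral_2_eq_2 hessian_def)

lemma bounded_integrable:
  assumes "continuous_on (closure unit_square) h" "integrable (lebesgue_on unit_square) g"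
  shows "integrable (lebesgue_on unit_square) (\<lambda>x. g x * h x :: real)"
proof -
  have sub: "unit_square \<subseteq> closure unit_square" by (rule closure_subset)
  have lm: "unit_square \<in> sets lebesgue" by (simp add: unit_square_box)
  have "compact (h ` closure unit_square)"
    using assms(1) by (intro compact_continuous_image) (auto simp: closure_unit_square)
  then have "\<exists>C. \<forall>x\<in>closure unit_square. \<bar>h x\<bar> \<le> C"
    by (auto simp: bounded_iff dest!: compact_imp_bounded)
  then obtain C where C: "\<And>x. x \<in> closure unit_square \<Longrightarrow> \<bar>h x\<bar> \<le> C" by blast
  have "h \<in> borel_measurable (lebesgue_on unit_square)"
    using continuous_imp_measurable_on_sets_lebesgue[OF continuous_on_subset[OF assms(1) sub] lm] .
  moreover have "AE x in lebesgue_on unit_square. norm (g x * h x) \<le> norm (C * g x)"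
  proof (rule AE_I2)
    fix x assume "x \<in> space (lebesgue_on unit_square)"
    then have "x \<in> closure unit_square" using sub by (auto simp: space_restrict_space)
    then have "\<bar>h x\<bar> \<le> \<bar>C\<bar>" using C[of x] by linarith
    then show "norm (g x * h x) \<le> norm (C * g x)"
      using mult_right_mono[of "\<bar>h x\<bar>" "\<bar>C\<bar>" "\<bar>g x\<bar>"]
      by (simp only: real_norm_def abs_mult mult.commute[of "\<bar>g x\<bar>"] abs_ge_zero)
  qed
  moreover have "integrable (lebesgue_on unit_square) (\<lambda>x. C * g x)" using assms(2) by simp
  ultimately show ?thesis
    using borel_measurable_integrable[OF assms(2)]
    by (intro Bochner_Integration.integrable_bound[of _ "\<lambda>x. C * g x" "\<lambda>x. g x * h x"]
        borel_measurable_times)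
qed

theorem J_has_first_variation:
  assumes f: "square_integrable (lebesgue_on unit_square) f"
    and u: "Ck 2 (closure unit_square) u" and v: "Ck 2 (closure unit_square) v"
  shows "((\<lambda>t. J f (\<lambda>x. u x + t * v x)) has_real_derivative DJ f u v) (at 0)"
proof -
  let ?M = "lebesgue_on unit_square"
  have "emeasure ?M (space ?M) < \<infinity>"
    by (simp add: space_restrict_space emeasure_restrict_space unit_square_box emeasure_lborel_box_eq)
  then interpret finite_measure ?M by (intro finite_measureI) auto
  define d where "d = (\<lambda>x. det (D2 u x))"
  define a where "a = (\<lambda>x. d x - f x)"
  define b where "b = (\<lambda>x. cofactor_matrix (D2 u x) \<bullet> D2 v x)"
  define c where "c = (\<lambda>x. det (D2 v x))"
  note cts = continuous_on_D2[OF u] continuous_on_D2[OF v]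
  have d: "continuous_on (closure unit_square) d" and b: "continuous_on (closure unit_square) b"
    and c: "continuous_on (closure unit_square) c"
    unfolding d_def b_def c_def frobenius cofactor_matrix_def det_2 sum_2 vector_2
    by (intro continuous_intros cts)+
  have int: "integrable ?M h" if "continuous_on (closure unit_square) h" for h :: "real^2 \<Rightarrow> real"
    using bounded_integrable[OF that, of "\<lambda>_. 1"] by simp
  have fi: "integrable ?M f"
    using f square_integrable_imp_integrable by (auto simp: square_integrable_def)
  have ai: "integrable ?M a" unfolding a_def using int[OF d] fi by simp
  have aa: "integrable ?M (\<lambda>x. (a x)\<^sup>2)"
  proof -
    have "(\<lambda>x. (a x)\<^sup>2) = (\<lambda>x. (d x)\<^sup>2 - 2 * (f x * d x) + (f x)\<^sup>2)"
      by (auto simp: a_def power2_eq_square algebra_simps)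
    moreover have "integrable ?M (\<lambda>x. (d x)\<^sup>2)" by (intro int continuous_intros d)
    ultimately show ?thesis
      using bounded_integrable[OF d fi] f by (simp add: square_integrable_def)
  qed
  have ab: "integrable ?M (\<lambda>x. a x * b x)" and ac: "integrable ?M (\<lambda>x. a x * c x)"
    by (intro bounded_integrable b c ai)+
  have bb: "integrable ?M (\<lambda>x. (b x)\<^sup>2)" and bc: "integrable ?M (\<lambda>x. b x * c x)"
    and cc: "integrable ?M (\<lambda>x. (c x)\<^sup>2)"
    by (intro int continuous_intros b c)+
  have expand: "J f (\<lambda>x. u x + t * v x) = 1/2 * ((LINT x|?M. (a x)\<^sup>2) + 2 * t * (LINT x|?M. a x * b x)
      + t^2 * ((LINT x|?M. (b x)\<^sup>2) + 2 * (LINT x|?M. a x * c x))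
      + 2 * t^3 * (LINT x|?M. b x * c x) + t^4 * (LINT x|?M. (c x)\<^sup>2))" for t
  proof -
    have "(det (D2 (\<lambda>x. u x + t * v x) x) - f x)\<^sup>2 =
        (a x)\<^sup>2 + 2 * t * (a x * b x) + t^2 * ((b x)\<^sup>2 + 2 * (a x * c x))
        + 2 * t^3 * (b x * c x) + t^4 * (c x)\<^sup>2" if "x \<in> space ?M" for x
    proof -
      have "x \<in> closure unit_square" using that closure_subset by (auto simp: space_restrict_space)
      then have "det (D2 (\<lambda>x. u x + t * v x) x) - f x = a x + t * b x + t\<^sup>2 * c x"
        by (simp add: D2_add_scaled u v det_add_scaled a_def b_def c_def d_def)
      then show ?thesis by (simp add: algebra_simps power2_eq_square power3_eq_cube power4_eq_xxxx)
    qed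
    then have "(LINT x|?M. (det (D2 (\<lambda>x. u x + t * v x) x) - f x)\<^sup>2) =
        (LINT x|?M. (a x)\<^sup>2 + 2 * t * (a x * b x) + t^2 * ((b x)\<^sup>2 + 2 * (a x * c x))
        + 2 * t^3 * (b x * c x) + t^4 * (c x)\<^sup>2)"
      by (rule Bochner_Integration.integral_cong[OF refl])
    then show ?thesis using aa ab ac bb bc cc unfolding J_def by simp
  qed
  have dj: "DJ f u v = (LINT x|?M. a x * b x)" by (simp add: DJ_def a_def b_def d_def)
  have poly: "((\<lambda>t. 1/2 * (A + 2 * t * B + t^2 * C + 2 * t^3 * D + t^4 * E)) has_real_derivative B) (at 0)"
    for A B C D E :: real
    by (auto intro!: derivative_eq_intros)
  have J_eq: "(\<lambda>t. J f (\<lambda>x. u x + t * v x)) = (\<lambda>t. 1/2 * ((LINT x|?M. (a x)\<^sup>2) + 2 * t * (LINT x|?M. a x * b x)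
      + t^2 * ((LINT x|?M. (b x)\<^sup>2) + 2 * (LINT x|?M. a x * c x))
      + 2 * t^3 * (LINT x|?M. b x * c x) + t^4 * (LINT x|?M. (c x)\<^sup>2)))"
    by (rule ext) (rule expand)
  show ?thesis unfolding J_eq dj by (rule poly)
qed

end

theory Submission
  imports Defs
begin

text \<open>
  Write \<open>g = det D\<^sup>2 u - f\<close> and \<open>M = cof D\<^sup>2 u\<close>, so that \<open>g\<close> is orthogonal in \<open>L\<^sup>2\<close> to every \<open>M : D\<^sup>2 v\<close>.
  In dimension two a uniformly elliptic \<open>M\<close> satisfies the Cordes condition: with
  \<open>\<gamma> = tr M / |M|\<^sup>2\<close> one has \<open>|I - \<gamma> M|\<^sup>2 \<le> 1 - \<epsilon>\<close>. If \<open>v\<close> is a finite sum of products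
  \<open>sin (m \<pi> x\<^sub>1) sin (n \<pi> x\<^sub>2)\<close>, then \<open>\<integral> |D\<^sup>2 v|\<^sup>2 = \<integral> (\<Delta> v)\<^sup>2\<close> by orthogonality. Hence \<open>w = g / \<gamma>\<close> satisfies
  \<open>\<epsilon> \<integral> h\<^sup>2 \<le> \<integral> (w - h)\<^sup>2\<close> for \<open>h = \<Delta> v\<close>, that is, for every finite double sine sum \<open>h\<close>.
  These are dense in \<open>L\<^sup>2\<close> by Stone--Weierstrass, because they are invariant under multiplication by
  \<open>cos (\<pi> x\<^sub>1)\<close> and \<open>cos (\<pi> x\<^sub>2)\<close>. So letting \<open>h\<close> tend to \<open>w\<close> gives \<open>w = 0\<close>.
\<close>

section \<open>Trigonometric sums on the unit square\<close>

lemma finite_measure_unit_square: "finite_measure (lebesgue_on unit_square)"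
proof (rule finite_measureI)
  show "emeasure (lebesgue_on unit_square) (space (lebesgue_on unit_square)) \<noteq> \<infinity>"
    by (simp add: space_restrict_space emeasure_restrict_space unit_square_box emeasure_lborel_box_eq)
qed

lemma integrable_unit_square:
  "continuous_on (closure unit_square) h \<Longrightarrow> integrable (lebesgue_on unit_square) (h :: real^2 \<Rightarrow> real)"
  using bounded_integrable[of h "\<lambda>_. 1"] finite_measure.integrable_const[OF finite_measure_unit_square, of "1::real"]
  by simp

text \<open>Fubini in coordinates: \<open>lborel\<close> is the image of the product of
  one-dimensional Lebesgue measures indexed by \<open>Basis\<close>, and the indicator of the square
  splits into one factor per coordinate.\<close>

lemma integral_unit_square_product:
  fixes F G :: "real \<Rightarrow> real"
  assumes F: "continuous_on UNIV F" and G: "continuous_on UNIV G"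
  shows "(LINT x|lebesgue_on unit_square. F (x$1) * G (x$2)) = (LBINT t=0..1. F t) * (LBINT t=0..1. G t)"
proof -
  define e :: "2 \<Rightarrow> real^2" where "e i = axis i 1" for i
  have ne: "e 1 \<noteq> e 2" by (simp add: e_def axis_eq_axis)
  have Bas: "(Basis :: (real^2) set) = {e 1, e 2}"
    by (auto simp: Basis_vec_def e_def UNIV_2)
  \<comment> \<open>For \<open>b\<close> in \<open>Basis\<close> the else branch means
    \<open>b = e 2\<close>.\<close>
  define P where "P b = (\<lambda>t::real. indicator {0<..<1} t * (if b = e 1 then F t else G t))" for b
  have [measurable]: "F \<in> borel_measurable borel" "G \<in> borel_measurable borel"
    using F G by (auto intro: borel_measurable_continuous_onI)
  have I: "integrable lborel (\<lambda>t. indicator {0<..<1} t * H t)" if "continuous_on UNIV H" for H :: "real \<Rightarrow> real"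
  proof -
    have "set_integrable lborel {0..1} H"
      by (rule borel_integrable_atLeastAtMost') (auto intro: continuous_on_subset[OF that])
    then have "set_integrable lborel {0<..<1} H"
      by (rule set_integrable_subset) auto
    then show ?thesis by (simp add: set_integrable_def)
  qed
  interpret product_sigma_finite "\<lambda>_::real^2. lborel :: real measure" ..
  have 1: "indicator unit_square x * (F (x$1) * G (x$2)) = (\<Prod>b\<in>Basis. P b (x \<bullet> b))" for x :: "real^2"
  proof -
    have "x \<in> unit_square \<longleftrightarrow> (0 < x$1 \<and> x$1 < 1) \<and> (0 < x$2 \<and> x$2 < 1)"
      by (auto simp: unit_square_def forall_2)
    then show ?thesis
      using ne by (simp add: Bas P_def e_def inner_axis indicator_def)
  qed
  have [measurable]: "P b \<in> borel_measurable borel" for b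
    unfolding P_def by measurable
  have "(LINT x|lebesgue_on unit_square. F (x$1) * G (x$2))
      = (LINT x|lebesgue. indicator unit_square x * (F (x$1) * G (x$2)))"
    by (subst integral_restrict_space) (auto simp: unit_square_box)
  \<comment> \<open>The integrand is Borel measurable, so completing the measure does not change its
    integral.\<close>
  also have "\<dots> = (LINT x|lborel. (\<Prod>b\<in>Basis. P b (x \<bullet> b)))"
    unfolding 1 by (rule integral_completion) measurable
  also have "\<dots> = (LINT x|(\<Pi>\<^sub>M b\<in>Basis. lborel). (\<Prod>b\<in>Basis. P b ((\<Sum>b\<in>Basis. x b *\<^sub>R b) \<bullet> b)))"
    by (subst lborel_eq, subst integral_distr) (measurable)
  also have "\<dots> = (LINT x|(\<Pi>\<^sub>M b\<in>Basis. lborel). (\<Prod>b\<in>Basis. P b (x b)))"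
    by (intro Bochner_Integration.integral_cong prod.cong refl)
      (simp add: inner_sum_left inner_Basis if_distrib sum.delta cong: if_cong)
  also have "\<dots> = (\<Prod>b\<in>Basis. LBINT t. P b t)"
  proof (rule product_integral_prod)
    show "integrable lborel (P b)" for b
      using I[OF F] I[OF G] by (cases "b = e 1") (simp_all add: P_def)
  qed simp
  also have "\<dots> = (LBINT t=0..1. F t) * (LBINT t=0..1. G t)"
    using ne by (simp add: Bas P_def interval_lebesgue_integral_le_eq set_lebesgue_integral_def
       zero_ereal_def one_ereal_def)
  finally show ?thesis .
qed

section \<open>Orthogonality of sines and cosines on the unit interval\<close>

lemma integral_cos_int_pi: "(LBINT t=0..1. cos (of_int k * pi * t)) = (if k = 0 then 1 else 0)"
proof (cases "k = 0")
  case True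
  then show ?thesis by (simp add: zero_ereal_def one_ereal_def)
next
  case False
  have "(LBINT t=ereal 0..ereal 1. cos (of_int k * pi * t))
      = sin (of_int k * pi * 1) / (of_int k * pi) - sin (of_int k * pi * 0) / (of_int k * pi)"
  proof (rule interval_integral_FTC_finite)
    show "continuous_on {min 0 1..max 0 1} (\<lambda>t. cos (of_int k * pi * t))"
      by (intro continuous_intros)
    show "((\<lambda>t. sin (of_int k * pi * t) / (of_int k * pi)) has_vector_derivative cos (of_int k * pi * t))
        (at t within {min 0 1..max 0 1})" for t
      using False
      by (auto intro!: derivative_eq_intros simp flip: has_real_derivative_iff_has_vector_derivative)
  qed
  then show ?thesis using False
    by (simp add: zero_ereal_def one_ereal_def mult.commute[of _ pi] sin_npi_int)
qed

lemma interval_integrable_01: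
  "continuous_on UNIV F \<Longrightarrow> interval_lebesgue_integrable lborel 0 1 (F :: real \<Rightarrow> real)"
  using interval_integrable_continuous_on[of 0 1 F] continuous_on_subset[of UNIV F]
  by (auto simp: zero_ereal_def one_ereal_def)

text \<open>The product-to-sum formulas leave cosines of frequency \<open>m - n\<close> and
  \<open>m + n\<close>, and only frequency 0 has a nonzero integral. Frequencies are integers here
  because the difference may be negative; the exceptional values at \<open>m = n = 0\<close> arise
  because the sum is 0 too.\<close>

lemma
  fixes m n :: nat
  shows integral_sin_sin: "(LBINT t=0..1. sin (m * pi * t) * sin (n * pi * t)) = (if m = n \<and> m \<noteq> 0 then 1/2 else 0)"
    and integral_cos_cos: "(LBINT t=0..1. cos (m * pi * t) * cos (n * pi * t)) =
      (if m = n then if m = 0 then 1 else 1/2 else 0)"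
proof -
  define d s where "d = int m - int n" and "s = int m + int n"
  note [simp] = interval_integrable_01 continuous_intros
  have "sin (m * pi * t) * sin (n * pi * t) = (cos (of_int d * pi * t) - cos (of_int s * pi * t)) / 2"
       "cos (m * pi * t) * cos (n * pi * t) = (cos (of_int d * pi * t) + cos (of_int s * pi * t)) / 2" for t
    by (simp_all add: d_def s_def sin_times_sin cos_times_cos algebra_simps)
  note product = this
  have "(LBINT t=0..1. sin (m * pi * t) * sin (n * pi * t)) =
      ((LBINT t=0..1. cos (of_int d * pi * t)) - (LBINT t=0..1. cos (of_int s * pi * t))) / 2"
    and "(LBINT t=0..1. cos (m * pi * t) * cos (n * pi * t)) =
      ((LBINT t=0..1. cos (of_int d * pi * t)) + (LBINT t=0..1. cos (of_int s * pi * t))) / 2"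
    unfolding product by simp_all
  then show "(LBINT t=0..1. sin (m * pi * t) * sin (n * pi * t)) = (if m = n \<and> m \<noteq> 0 then 1/2 else 0)"
    and "(LBINT t=0..1. cos (m * pi * t) * cos (n * pi * t)) = (if m = n then if m = 0 then 1 else 1/2 else 0)"
    unfolding integral_cos_int_pi by (auto simp: d_def s_def)
qed

section \<open>Double trigonometric sums and the Poisson problem\<close>

definition trig_sum :: "(real \<Rightarrow> real) \<Rightarrow> (real \<Rightarrow> real) \<Rightarrow> (nat \<times> nat \<Rightarrow> real) \<Rightarrow> (nat \<times> nat) set \<Rightarrow> real^2 \<Rightarrow> real" where
  "trig_sum p q c K x = (\<Sum>k\<in>K. c k * p (real (fst k) * pi * x$1) * q (real (snd k) * pi * x$2))"

lemma continuous_on_trig_sum: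
  assumes "continuous_on UNIV p" "continuous_on UNIV q"
  shows "continuous_on A (trig_sum p q c K)"
  unfolding trig_sum_def
  by (intro continuous_intros continuous_on_compose2[OF assms(1)] continuous_on_compose2[OF assms(2)]) auto

lemma trig_sum_has_derivative:
  assumes "\<And>t. (p has_real_derivative p' t) (at t)" "\<And>t. (q has_real_derivative q' t) (at t)"
  shows "(trig_sum p q c K has_derivative
     (\<lambda>h. trig_sum p' q (\<lambda>k. real (fst k) * pi * c k) K x * h$1 + trig_sum p q' (\<lambda>k. real (snd k) * pi * c k) K x * h$2)) (at x within A)"
proof -
  have 1: "((\<lambda>x::real^2. p (a * x$1)) has_derivative (\<lambda>h. p' (a * x$1) * (a * h$1))) (at x within A)" for a x
    by (rule has_derivative_compose[OF _ assms(1)[unfolded has_field_derivative_def]])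
       (intro bounded_linear_imp_has_derivative bounded_linear_const_mult bounded_linear_vec_nth)
  have 2: "((\<lambda>x::real^2. q (a * x$2)) has_derivative (\<lambda>h. q' (a * x$2) * (a * h$2))) (at x within A)" for a x
    by (rule has_derivative_compose[OF _ assms(2)[unfolded has_field_derivative_def]])
       (intro bounded_linear_imp_has_derivative bounded_linear_const_mult bounded_linear_vec_nth)
  have "((\<lambda>x::real^2. \<Sum>k\<in>K. c k * p (real (fst k) * pi * x$1) * q (real (snd k) * pi * x$2)) has_derivative
     (\<lambda>h. \<Sum>k\<in>K. c k * p (real (fst k) * pi * x$1) * (q' (real (snd k) * pi * x$2) * (real (snd k) * pi * h$2)) +
        c k * (p' (real (fst k) * pi * x$1) * (real (fst k) * pi * h$1)) * q (real (snd k) * pi * x$2))) (at x within A)"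
    by (intro has_derivative_sum has_derivative_mult has_derivative_mult_right 1 2)
  then show ?thesis
    by (simp add: trig_sum_def[abs_def] sum_distrib_left sum_distrib_right sum.distrib algebra_simps)
qed

text \<open>Agreement with the sum is asked only on the closed square, since no more is known of a
  first partial derivative when the lemma is applied to it again. Derivatives remain sums of the
  same kind: the profiles change and the coefficients absorb the frequency.\<close>

lemma partial_trig_sum:
  assumes "\<And>t. (p has_real_derivative p' t) (at t)" "\<And>t. (q has_real_derivative q' t) (at t)"
    and u: "\<forall>y\<in>closure unit_square. u y = trig_sum p q c K y"
  shows "u differentiable_on closure unit_square"
    and "\<forall>x\<in>closure unit_square. partial (closure unit_square) 1 u x = trig_sum p' q (\<lambda>k. real (fst k) * pi * c k) K x"
    and "\<forall>x\<in>closure unit_square. partial (closure unit_square) 2 u x = trig_sum p q' (\<lambda>k. real (snd k) * pi * c k) K x"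
proof -
  have D: "(u has_derivative (\<lambda>h. trig_sum p' q (\<lambda>k. real (fst k) * pi * c k) K x * h$1 +
      trig_sum p q' (\<lambda>k. real (snd k) * pi * c k) K x * h$2)) (at x within closure unit_square)"
    if "x \<in> closure unit_square" for x
    by (rule has_derivative_transform[OF that _ trig_sum_has_derivative[OF assms(1,2)]]) (rule u[rule_format])
  then show "u differentiable_on closure unit_square"
    unfolding differentiable_on_def differentiable_def by blast
  show "\<forall>x\<in>closure unit_square. partial (closure unit_square) 1 u x = trig_sum p' q (\<lambda>k. real (fst k) * pi * c k) K x"
    "\<forall>x\<in>closure unit_square. partial (closure unit_square) 2 u x = trig_sum p q' (\<lambda>k. real (snd k) * pi * c k) K x"
    by (simp_all add: partial_eq[OF D] axis_def)
qed

lemma integral_trig_sum_mult: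
  assumes "continuous_on UNIV p" "continuous_on UNIV q" "continuous_on UNIV p'" "continuous_on UNIV q'"
  shows "(LINT x|lebesgue_on unit_square. trig_sum p q a K x * trig_sum p' q' b L x) =
    (\<Sum>k\<in>K. \<Sum>l\<in>L. a k * b l * ((LBINT t=0..1. p (real (fst k) * pi * t) * p' (real (fst l) * pi * t)) *
       (LBINT t=0..1. q (real (snd k) * pi * t) * q' (real (snd l) * pi * t))))"
proof -
  note cts = continuous_on_compose2[OF assms(1)] continuous_on_compose2[OF assms(2)]
     continuous_on_compose2[OF assms(3)] continuous_on_compose2[OF assms(4)]
  define E where "E k l x = (p (real (fst k) * pi * x$1) * p' (real (fst l) * pi * x$1)) *
      (q (real (snd k) * pi * x$2) * q' (real (snd l) * pi * x$2))" for k l :: "nat \<times> nat" and x :: "real^2"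
  have int: "integrable (lebesgue_on unit_square) (E k l)" for k l
    unfolding E_def by (intro integrable_unit_square continuous_intros cts) auto
  have "trig_sum p q a K x * trig_sum p' q' b L x = (\<Sum>k\<in>K. \<Sum>l\<in>L. a k * b l * E k l x)" for x
    by (simp add: trig_sum_def sum_product E_def mult_ac)
  then have "(LINT x|lebesgue_on unit_square. trig_sum p q a K x * trig_sum p' q' b L x) =
      (\<Sum>k\<in>K. \<Sum>l\<in>L. a k * b l * (LINT x|lebesgue_on unit_square. E k l x))"
    by (simp add: int)
  moreover have "(LINT x|lebesgue_on unit_square. E k l x) =
     (LBINT t=0..1. p (real (fst k) * pi * t) * p' (real (fst l) * pi * t)) *
       (LBINT t=0..1. q (real (snd k) * pi * t) * q' (real (snd l) * pi * t))" for k l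
    unfolding E_def
    by (rule integral_unit_square_product[of "\<lambda>t. p (real (fst k) * pi * t) * p' (real (fst l) * pi * t)"
      "\<lambda>t. q (real (snd k) * pi * t) * q' (real (snd l) * pi * t)"]) (intro continuous_intros cts; auto)+
  ultimately show ?thesis by simp
qed

text \<open>Each mode is an eigenfunction of the Dirichlet Laplacian, so the Poisson equation is
  solved coefficient by coefficient. The last identity says that the integral of
  \<open>det (D2 v x)\<close> vanishes, which orthogonality shows.\<close>

lemma inverse_laplacian_trig_sum:
  obtains v where "Ck 2 (closure unit_square) v" "\<And>x. x \<in> frontier unit_square \<Longrightarrow> v x = 0"
    "\<And>x. x \<in> closure unit_square \<Longrightarrow> D2 v x $ 1 $ 1 + D2 v x $ 2 $ 2 = trig_sum sin sin b K x"
    "\<And>x. x \<in> closure unit_square \<Longrightarrow> D2 v x $ 1 $ 2 = D2 v x $ 2 $ 1"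
    "(LINT x|lebesgue_on unit_square. D2 v x \<bullet> D2 v x) = (LINT x|lebesgue_on unit_square. (trig_sum sin sin b K x)\<^sup>2)"
proof -
  let ?S = "closure unit_square"
  let ?ms = "\<lambda>t::real. - sin t"
  \<comment> \<open>At frequency \<open>(0, 0)\<close> this divides by 0, but that mode vanishes identically.\<close>
  define c where "c k = - b k / (pi\<^sup>2 * ((real (fst k))\<^sup>2 + (real (snd k))\<^sup>2))" for k
  define v where "v = trig_sum sin sin c K"
  note ds = DERIV_sin DERIV_cos
  define c11 where "c11 k = pi\<^sup>2 * real (fst k) * real (fst k) * c k" for k
  define c12 where "c12 k = pi\<^sup>2 * real (fst k) * real (snd k) * c k" for k
  define c22 where "c22 k = pi\<^sup>2 * real (snd k) * real (snd k) * c k" for k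
  have "\<forall>y\<in>?S. v y = trig_sum sin sin c K y" by (simp add: v_def)
  note p1 = partial_trig_sum[OF ds(1) ds(1) this]
  note p11 = partial_trig_sum[OF ds(2) ds(1), of "partial ?S 1 v", OF p1(2)]
  note p22 = partial_trig_sum[OF ds(1) ds(2), of "partial ?S 2 v", OF p1(3)]
  have D: "D2 v x $ 1 $ 1 = trig_sum ?ms sin c11 K x" "D2 v x $ 1 $ 2 = trig_sum cos cos c12 K x"
    "D2 v x $ 2 $ 1 = trig_sum cos cos c12 K x" "D2 v x $ 2 $ 2 = trig_sum sin ?ms c22 K x"
    if "x \<in> ?S" for x
    using p11(2,3)[rule_format, OF that] p22(2,3)[rule_format, OF that]
    by (simp_all add: hessian_def trig_sum_def c11_def c12_def c22_def power2_eq_square mult_ac)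
  have cts: "continuous_on UNIV (sin :: real \<Rightarrow> real)" "continuous_on UNIV (cos :: real \<Rightarrow> real)"
    "continuous_on UNIV (\<lambda>t :: real. - sin t)"
    by (auto intro!: continuous_intros)
  have continuous_on_trig_eq: "continuous_on ?S w" if "continuous_on ?S z" "\<forall>x\<in>?S. w x = z x"
    for w z :: "real^2 \<Rightarrow> real"
    using that continuous_on_cong[of ?S ?S w z] by simp
  have Ck2: "Ck 2 ?S v"
    unfolding numeral_2_eq_2 Ck.simps forall_2
    by (intro conjI p1(1) p11(1) p22(1) p11(2,3)[THEN continuous_on_trig_eq[rotated]]
        p22(2,3)[THEN continuous_on_trig_eq[rotated]] continuous_on_trig_sum cts)
  have bdry: "v x = 0" if "x \<in> frontier unit_square" for x
  proof -
    have "x \<in> closure unit_square" "x \<notin> unit_square"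
      using that open_box[of 0 "(\<chi> i. 1) :: real^2"] by (auto simp: frontier_def unit_square_box[symmetric] interior_open)
    then have "x$1 \<in> {0,1} \<or> x$2 \<in> {0,1}"
      unfolding closure_unit_square by (auto simp: unit_square_def mem_box_cart forall_2)
    then show ?thesis by (auto simp: v_def trig_sum_def mult.commute[of _ pi])
  qed
  have lap: "D2 v x $ 1 $ 1 + D2 v x $ 2 $ 2 = trig_sum sin sin b K x" if "x \<in> ?S" for x
  proof -
    \<comment> \<open>The sine factor is kept so that the identity survives a zero first frequency,
      where both sides vanish; otherwise the denominator in \<open>c\<close> is positive.\<close>
    have "(c11 k + c22 k) * sin (real (fst k) * pi * x$1) = - b k * sin (real (fst k) * pi * x$1)" for k
    proof (cases "real (fst k) = 0")
      case False
      then have "(real (fst k))\<^sup>2 + (real (snd k))\<^sup>2 \<noteq> 0" by (simp add: sum_power2_eq_zero_iff)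
      moreover have "c11 k + c22 k = (pi\<^sup>2 * ((real (fst k))\<^sup>2 + (real (snd k))\<^sup>2)) * c k"
        by (simp add: c11_def c22_def power2_eq_square algebra_simps)
      ultimately have "c11 k + c22 k = - b k" by (simp add: c_def)
      then show ?thesis by simp
    qed simp
    note * = this
    have "b k * sin (real (fst k) * pi * x$1) * z = - (c11 k * sin (real (fst k) * pi * x$1) * z) - c22 k * sin (real (fst k) * pi * x$1) * z" for k z
      using *[of k] by algebra
    then show ?thesis
      by (simp add: D[OF that] trig_sum_def sum_negf sum_subtractf)
  qed
  have "(LINT x|lebesgue_on unit_square. trig_sum cos cos c12 K x * trig_sum cos cos c12 K x) =
     (LINT x|lebesgue_on unit_square. trig_sum ?ms sin c11 K x * trig_sum sin ?ms c22 K x)"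
    unfolding integral_trig_sum_mult[OF cts(2,2,2,2)] integral_trig_sum_mult[OF cts(3,1,1,3)]
    \<comment> \<open>At a zero frequency the sine and cosine integrals differ, but there both
      products of coefficients vanish.\<close>
    by (intro sum.cong refl) 
       (auto simp: integral_sin_sin integral_cos_cos interval_lebesgue_integral_uminus c11_def c12_def c22_def)
  \<comment> \<open>For a symmetric matrix of order two the squared norm is the squared trace minus
    twice the determinant.\<close>
  moreover have "(LINT x|lebesgue_on unit_square. D2 v x \<bullet> D2 v x) =
     (LINT x|lebesgue_on unit_square. (trig_sum sin sin b K x)\<^sup>2
       + 2 * (trig_sum cos cos c12 K x * trig_sum cos cos c12 K x)
       - 2 * (trig_sum ?ms sin c11 K x * trig_sum sin ?ms c22 K x))"
  proof (rule Bochner_Integration.integral_cong[OF refl])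
    fix x assume "x \<in> space (lebesgue_on unit_square)"
    then have "x \<in> ?S" using closure_subset by (auto simp: space_restrict_space)
    note D = D[OF this]
    have "trig_sum sin sin b K x = trig_sum ?ms sin c11 K x + trig_sum sin ?ms c22 K x"
      using lap[OF \<open>x \<in> ?S\<close>] D by simp
    then show "D2 v x \<bullet> D2 v x = (trig_sum sin sin b K x)\<^sup>2
       + 2 * (trig_sum cos cos c12 K x * trig_sum cos cos c12 K x)
       - 2 * (trig_sum ?ms sin c11 K x * trig_sum sin ?ms c22 K x)"
      by (simp only: frobenius sum_2 D) (simp add: power2_eq_square algebra_simps)
  qed
  ultimately have energy: "(LINT x|lebesgue_on unit_square. D2 v x \<bullet> D2 v x) = (LINT x|lebesgue_on unit_square. (trig_sum sin sin b K x)\<^sup>2)"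
    by (simp add: integrable_unit_square continuous_on_trig_sum cts continuous_intros)
  show thesis
    by (rule that[OF Ck2 bdry lap _ energy]) (simp_all add: D)
qed

section \<open>Density of the sine sums in the square-integrable functions\<close>

definition sine_polys :: "(real^2 \<Rightarrow> real) set" where
  "sine_polys = {h. \<exists>c K. finite K \<and> h = trig_sum sin sin c K}"

lemma sine_mode: "(\<lambda>x. a * (sin (real m * pi * x$1) * sin (real n * pi * x$2))) \<in> sine_polys"
  unfolding sine_polys_def
  by (auto intro!: exI[of _ "\<lambda>_. a"] exI[of _ "{(m, n)}"] simp: trig_sum_def fun_eq_iff)

lemma sine_polys_add:
  assumes "g \<in> sine_polys" "h \<in> sine_polys"
  shows "(\<lambda>x. g x + h x) \<in> sine_polys"
proof -
  obtain c K d L where *: "finite K" "finite L" "g = trig_sum sin sin c K" "h = trig_sum sin sin d L"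
    using assms by (auto simp: sine_polys_def)
  \<comment> \<open>Coefficients are arbitrary outside their index set, so they are cut to 0 there
    before the two sets are merged.\<close>
  let ?c = "\<lambda>k. (if k \<in> K then c k else 0)" and ?d = "\<lambda>k. (if k \<in> L then d k else 0)"
  have "trig_sum sin sin c K = trig_sum sin sin ?c (K \<union> L)" "trig_sum sin sin d L = trig_sum sin sin ?d (K \<union> L)"
    unfolding trig_sum_def using *(1,2) by (auto intro!: ext sum.mono_neutral_cong_left)
  then have "(\<lambda>x. g x + h x) = trig_sum sin sin (\<lambda>k. ?c k + ?d k) (K \<union> L)"
    unfolding *(3,4) by (simp add: trig_sum_def[abs_def] distrib_right sum.distrib)
  then show ?thesis using *(1,2) unfolding sine_polys_def by blast
qed

text \<open>Linear closure properties then need checking on a single mode only. The empty sum is a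
  mode with amplitude 0.\<close>

lemma sine_polys_induct [consumes 1, case_names mode add]:
  assumes "h \<in> sine_polys"
    and mode: "\<And>a m n. P (\<lambda>x. a * (sin (real m * pi * x$1) * sin (real n * pi * x$2)))"
    and add: "\<And>g h. P g \<Longrightarrow> P h \<Longrightarrow> P (\<lambda>x. g x + h x)"
  shows "P h"
proof -
  obtain c K where "finite K" and h: "h = trig_sum sin sin c K"
    using assms(1) by (auto simp: sine_polys_def)
  from \<open>finite K\<close> show ?thesis unfolding h
  proof induction
    case empty
    show ?case using mode[of 0] by (simp add: trig_sum_def[abs_def])
  next
    case (insert k K)
    then show ?case using add[OF mode[of "c k" "fst k" "snd k"] insert.IH]
      by (simp add: trig_sum_def[abs_def] mult.assoc)
  qed
qed

lemma sine_polys_scale: "h \<in> sine_polys \<Longrightarrow> (\<lambda>x. a * h x) \<in> sine_polys"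
proof (induction rule: sine_polys_induct)
  case (mode b m n)
  then show ?case using sine_mode[of "a * b" m n] by (simp add: mult.assoc)
qed (simp add: sine_polys_add distrib_left)

text \<open>The product has the frequencies \<open>m + 1\<close> and \<open>m - 1\<close>. The case
  \<open>m = 0\<close> is separate because \<open>m - 1\<close> is not natural there; the left side
  is then 0.\<close>

lemma sin_times_cos_pi:
  obtains b c :: real and p q :: nat
  where "\<And>t. sin (real m * pi * t) * cos (pi * t) = b * sin (real p * pi * t) + c * sin (real q * pi * t)"
proof (cases m)
  case 0
  show ?thesis by (rule that[of 0 0 0 0]) (simp add: 0)
next
  case (Suc n)
  show ?thesis
  proof (rule that[of "1/2" "Suc (Suc n)" "1/2" n])
    fix t :: real
    have "real m * pi * t + pi * t = real (Suc (Suc n)) * pi * t" "real m * pi * t - pi * t = real n * pi * t"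
      by (simp_all add: Suc algebra_simps)
    then show "sin (real m * pi * t) * cos (pi * t) = 1/2 * sin (real (Suc (Suc n)) * pi * t) + 1/2 * sin (real n * pi * t)"
      by (simp only: sin_times_cos) simp
  qed
qed

text \<open>Sine sums are not closed under products, but these two rules make them a module over the
  polynomials in the two cosines, which is what Stone--Weierstrass can use.\<close>

lemma sine_polys_mult_cos:
  assumes "h \<in> sine_polys"
  shows "(\<lambda>x. cos (pi * x$1) * h x) \<in> sine_polys" "(\<lambda>x. cos (pi * x$2) * h x) \<in> sine_polys"
proof -
  show "(\<lambda>x. cos (pi * x$1) * h x) \<in> sine_polys"
    using assms
  proof (induction rule: sine_polys_induct)
    case (mode a m n)
    obtain b c p q where *: "\<And>t. sin (real m * pi * t) * cos (pi * t) = b * sin (real p * pi * t) + c * sin (real q * pi * t)"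
      by (rule sin_times_cos_pi[of m], rule that)
    have "cos (pi * x$1) * (a * (sin (real m * pi * x$1) * sin (real n * pi * x$2))) =
        a * b * (sin (real p * pi * x$1) * sin (real n * pi * x$2)) +
        a * c * (sin (real q * pi * x$1) * sin (real n * pi * x$2))" for x :: "real^2"
      using *[of "x$1"] by algebra
    then show ?case using sine_polys_add[OF sine_mode sine_mode] by simp
  qed (simp add: distrib_left sine_polys_add)
  show "(\<lambda>x. cos (pi * x$2) * h x) \<in> sine_polys"
    using assms
  proof (induction rule: sine_polys_induct)
    case (mode a m n)
    obtain b c p q where *: "\<And>t. sin (real n * pi * t) * cos (pi * t) = b * sin (real p * pi * t) + c * sin (real q * pi * t)"
      by (rule sin_times_cos_pi[of n], rule that)
    have "cos (pi * x$2) * (a * (sin (real m * pi * x$1) * sin (real n * pi * x$2))) =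
        a * b * (sin (real m * pi * x$1) * sin (real p * pi * x$2)) +
        a * c * (sin (real m * pi * x$1) * sin (real q * pi * x$2))" for x :: "real^2"
      using *[of "x$2"] by algebra
    then show ?case using sine_polys_add[OF sine_mode sine_mode] by simp
  qed (simp add: distrib_left sine_polys_add)
qed

section \<open>Uniform approximation with a weight vanishing on the boundary\<close>

definition sine_weight :: "real^2 \<Rightarrow> real" where
  "sine_weight x = sin (pi * x$1) * sin (pi * x$2)"

lemma sine_weight_pos: "x \<in> unit_square \<Longrightarrow> 0 < sine_weight x"
  unfolding sine_weight_def unit_square_def by (auto intro!: mult_pos_pos sin_gt_zero)

lemma sine_weight_nonneg:
  assumes "x \<in> closure unit_square" shows "0 \<le> sine_weight x"
proof -
  have "0 \<le> x$i \<and> x$i \<le> 1" for i using assms by (simp add: closure_unit_square mem_box_cart)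
  then show ?thesis unfolding sine_weight_def by (intro mult_nonneg_nonneg sin_ge_zero) auto
qed

lemma sine_weight_le_1: "\<bar>sine_weight x\<bar> \<le> 1"
  unfolding sine_weight_def abs_mult by (intro mult_le_one) auto

text \<open>Sine sums vanish on the boundary, so they cannot approximate every continuous
  \<open>q\<close> uniformly. Instead \<open>q\<close> is approximated by multipliers of the sine
  sums, and multiplying by the lowest mode \<open>sine_weight\<close> leads back into the sine
  sums.\<close>

lemma sine_polys_uniformly_dense:
  assumes "continuous_on (closure unit_square) q" "0 < \<epsilon>"
  obtains h where "h \<in> sine_polys" "\<And>x. x \<in> closure unit_square \<Longrightarrow> \<bar>sine_weight x * q x - h x\<bar> < \<epsilon>"
proof -
  let ?S = "closure unit_square"
  \<comment> \<open>The multipliers of the sine sums form an algebra that contains both cosines.\<close>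
  define R where "R = {f. continuous_on ?S f \<and> (\<forall>h\<in>sine_polys. (\<lambda>x. f x * h x) \<in> sine_polys)}"
  have cos: "(\<lambda>x. cos (pi * x$1)) \<in> R" "(\<lambda>x. cos (pi * x$2)) \<in> R"
    by (auto simp: R_def sine_polys_mult_cos intro!: continuous_intros)
  interpret function_ring_on R ?S
  proof
    show "compact ?S" by (simp add: closure_unit_square)
    show "continuous_on ?S f" if "f \<in> R" for f using that by (simp add: R_def)
    show "(\<lambda>x. f x + g x) \<in> R" if "f \<in> R" "g \<in> R" for f g
      using that by (auto simp: R_def distrib_right intro!: continuous_intros sine_polys_add)
    show "(\<lambda>x. f x * g x) \<in> R" if "f \<in> R" "g \<in> R" for f g
      using that by (auto simp: R_def mult.assoc intro!: continuous_intros)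
    show "(\<lambda>_. c) \<in> R" for c
      by (auto simp: R_def sine_polys_scale)
    show "\<exists>f\<in>R. f x \<noteq> f y" if "x \<in> ?S" "y \<in> ?S" "x \<noteq> y" for x y
    proof -
      obtain i where i: "x$i \<noteq> y$i" using \<open>x \<noteq> y\<close> by (auto simp: vec_eq_iff)
      have "0 \<le> x$i" "x$i \<le> 1" "0 \<le> y$i" "y$i \<le> 1"
        using that by (auto simp: closure_unit_square mem_box_cart)
      \<comment> \<open>Points are separated because cosine is injective on the interval from 0 to
        \<open>pi\<close>.\<close>
      then have "cos (pi * x$i) \<noteq> cos (pi * y$i)"
        using i cos_inj_pi[of "pi * x$i" "pi * y$i"] by auto
      moreover have "(\<lambda>x. cos (pi * x$i)) \<in> R" using cos exhaust_2[of i] by auto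
      ultimately show ?thesis by (rule bexI)
    qed
  qed
  obtain g where g: "g \<in> R" "\<And>x. x \<in> ?S \<Longrightarrow> \<bar>q x - g x\<bar> < \<epsilon>"
    using Stone_Weierstrass_basic[OF assms] by blast
  have "sine_weight \<in> sine_polys"
    using sine_mode[of 1 1 1] by (simp add: sine_weight_def[abs_def])
  then have "(\<lambda>x. g x * sine_weight x) \<in> sine_polys" using g(1) by (simp add: R_def)
  then show thesis
  proof (rule that)
    fix x assume "x \<in> ?S"
    have "\<bar>sine_weight x * q x - g x * sine_weight x\<bar> = \<bar>sine_weight x\<bar> * \<bar>q x - g x\<bar>"
      by (simp add: algebra_simps flip: abs_mult)
    also have "\<dots> \<le> \<bar>q x - g x\<bar>" by (intro mult_left_le_one_le sine_weight_le_1) auto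
    finally show "\<bar>sine_weight x * q x - g x * sine_weight x\<bar> < \<epsilon>" using g(2)[OF \<open>x \<in> ?S\<close>] by simp
  qed
qed

text \<open>Membership in the mean-square closure of the sine sums. Integrability is demanded
  explicitly because the integral of a non-integrable function is 0, which would satisfy the bound
  vacuously.\<close>

definition L2_sine_limit :: "(real^2 \<Rightarrow> real) \<Rightarrow> bool" where
  "L2_sine_limit w \<longleftrightarrow> w \<in> borel_measurable (lebesgue_on unit_square) \<and>
    (\<forall>\<epsilon>>0. \<exists>h\<in>sine_polys. integrable (lebesgue_on unit_square) (\<lambda>x. (w x - h x)\<^sup>2) \<and>
      (LINT x|lebesgue_on unit_square. (w x - h x)\<^sup>2) < \<epsilon>)"

lemma sine_polys_continuous: "h \<in> sine_polys \<Longrightarrow> continuous_on A h"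
  by (auto simp: sine_polys_def intro!: continuous_on_trig_sum continuous_intros)

lemma measurable_unit_square:
  "continuous_on (closure unit_square) h \<Longrightarrow> (h :: real^2 \<Rightarrow> real) \<in> borel_measurable (lebesgue_on unit_square)"
  using integrable_unit_square by (rule borel_measurable_integrable)

text \<open>Dominated convergence turns the pointwise limit into a mean-square limit, and the
  closure of a closure adds nothing new.\<close>

lemma L2_sine_limit_dominated:
  assumes w: "w \<in> borel_measurable (lebesgue_on unit_square)"
    and W: "\<And>n. L2_sine_limit (W n)"
    and lim: "AE x in lebesgue_on unit_square. (\<lambda>n. W n x) \<longlonglongrightarrow> w x"
    and G: "integrable (lebesgue_on unit_square) (\<lambda>x. (G x)\<^sup>2)"
    and bound: "\<And>n. AE x in lebesgue_on unit_square. \<bar>W n x\<bar> \<le> G x"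
  shows "L2_sine_limit w"
  unfolding L2_sine_limit_def
proof (intro conjI allI impI w)
  let ?M = "lebesgue_on unit_square"
  fix \<epsilon> :: real assume "0 < \<epsilon>"
  have [measurable]: "w \<in> borel_measurable ?M" "W n \<in> borel_measurable ?M" for n
    using w W by (auto simp: L2_sine_limit_def)
  have lim2: "AE x in ?M. (\<lambda>n. (w x - W n x)\<^sup>2) \<longlonglongrightarrow> 0"
    using lim
  proof eventually_elim
    case (elim x)
    have "(\<lambda>n. (w x - W n x)\<^sup>2) \<longlonglongrightarrow> (w x - w x)\<^sup>2" by (intro tendsto_intros elim)
    then show ?case by simp
  qed
  have bound': "AE x in ?M. \<forall>n. \<bar>W n x\<bar> \<le> G x"
    using bound by (simp add: AE_all_countable)
  \<comment> \<open>The bound \<open>G\<close> passes to the limit \<open>w\<close>, so the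
    difference is at most \<open>2 * G\<close>; squaring gives the factor 4.\<close>
  have bound2: "AE x in ?M. norm ((w x - W n x)\<^sup>2) \<le> 4 * (G x)\<^sup>2" for n
    using lim bound'
  proof eventually_elim
    case (elim x)
    have "\<bar>w x\<bar> \<le> G x"
      by (rule LIMSEQ_le_const2[OF tendsto_rabs[OF elim(1)]]) (use elim(2) in auto)
    with elim(2)[rule_format, of n] have "\<bar>w x - W n x\<bar> \<le> 2 * G x" by linarith
    from power_mono[OF this, of 2] show ?case by (simp add: power_mult_distrib)
  qed
  have int: "integrable ?M (\<lambda>x. (w x - W n x)\<^sup>2)" for n
  proof (rule Bochner_Integration.integrable_bound)
    show "integrable ?M (\<lambda>x. 4 * (G x)\<^sup>2)" using G by simp
    show "AE x in ?M. norm ((w x - W n x)\<^sup>2) \<le> norm (4 * (G x)\<^sup>2)"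
      using bound2[of n] by simp
  qed measurable
  have "(\<lambda>n. LINT x|?M. (w x - W n x)\<^sup>2) \<longlonglongrightarrow> (LINT x|?M. 0)"
  proof (rule integral_dominated_convergence)
    show "integrable ?M (\<lambda>x. 4 * (G x)\<^sup>2)" using G by simp
  qed (use lim2 bound2 in measurable)
  then have "(\<lambda>n. LINT x|?M. (w x - W n x)\<^sup>2) \<longlonglongrightarrow> 0" by simp
  \<comment> \<open>The square of a sum is at most twice the sum of the squares, so two errors below
    \<open>\<epsilon> / 4\<close> add up to less than \<open>\<epsilon>\<close>.\<close>
  then have "\<forall>\<^sub>F n in sequentially. (LINT x|?M. (w x - W n x)\<^sup>2) < \<epsilon> / 4"
    using \<open>0 < \<epsilon>\<close> by (intro order_tendstoD) auto
  then obtain n where n: "(LINT x|?M. (w x - W n x)\<^sup>2) < \<epsilon> / 4"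
    by (auto simp: eventually_sequentially)
  have "0 < \<epsilon> / 4" using \<open>0 < \<epsilon>\<close> by simp
  then obtain h where h: "h \<in> sine_polys" "integrable ?M (\<lambda>x. (W n x - h x)\<^sup>2)"
      "(LINT x|?M. (W n x - h x)\<^sup>2) < \<epsilon> / 4"
    using W[of n] unfolding L2_sine_limit_def by blast
  have [measurable]: "h \<in> borel_measurable ?M"
    by (intro measurable_unit_square sine_polys_continuous h)
  have le: "(w x - h x)\<^sup>2 \<le> 2 * (w x - W n x)\<^sup>2 + 2 * (W n x - h x)\<^sup>2" for x
    using zero_le_power2[of "(w x - W n x) - (W n x - h x)"] by (simp add: power2_eq_square algebra_simps)
  have int2: "integrable ?M (\<lambda>x. 2 * (w x - W n x)\<^sup>2 + 2 * (W n x - h x)\<^sup>2)"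
    using int h by auto
  have int3: "integrable ?M (\<lambda>x. (w x - h x)\<^sup>2)"
    by (rule Bochner_Integration.integrable_bound[OF int2]) (use le in auto)
  have "(LINT x|?M. (w x - h x)\<^sup>2) \<le> (LINT x|?M. 2 * (w x - W n x)\<^sup>2 + 2 * (W n x - h x)\<^sup>2)"
    by (intro integral_mono int2 int3 le)
  also have "\<dots> < \<epsilon>" using n h int by simp
  finally show "\<exists>h\<in>sine_polys. integrable ?M (\<lambda>x. (w x - h x)\<^sup>2) \<and> (LINT x|?M. (w x - h x)\<^sup>2) < \<epsilon>"
    using h(1) int3 by blast
qed

lemma L2_sine_limit_weight_mult:
  assumes q: "continuous_on (closure unit_square) q"
  shows "L2_sine_limit (\<lambda>x. sine_weight x * q x)"
  unfolding L2_sine_limit_def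
proof (intro conjI allI impI)
  let ?M = "lebesgue_on unit_square"
  have ct: "continuous_on (closure unit_square) (\<lambda>x. sine_weight x * q x)"
    unfolding sine_weight_def by (intro continuous_intros q)
  then show "(\<lambda>x. sine_weight x * q x) \<in> borel_measurable ?M" by (rule measurable_unit_square)
  interpret finite_measure ?M by (rule finite_measure_unit_square)
  let ?m = "measure ?M (space ?M)"
  fix \<epsilon> :: real assume "0 < \<epsilon>"
  \<comment> \<open>Adding 1 to the measure keeps the quotient defined and makes the final estimate
    strict.\<close>
  then have "0 < sqrt (\<epsilon> / (?m + 1))" by (simp add: add_nonneg_pos)
  from sine_polys_uniformly_dense[OF q this] obtain h where h: "h \<in> sine_polys"
    "\<And>x. x \<in> closure unit_square \<Longrightarrow> \<bar>sine_weight x * q x - h x\<bar> < sqrt (\<epsilon> / (?m + 1))" by blast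
  have int: "integrable ?M (\<lambda>x. (sine_weight x * q x - h x)\<^sup>2)"
    by (intro integrable_unit_square continuous_intros ct sine_polys_continuous h)
  have "(sine_weight x * q x - h x)\<^sup>2 \<le> \<epsilon> / (?m + 1)" if "x \<in> space ?M" for x
  proof -
    have "x \<in> closure unit_square" using that closure_subset by (auto simp: space_restrict_space)
    from power_mono[OF less_imp_le[OF h(2)[OF this]], of 2] show ?thesis
      using \<open>0 < \<epsilon>\<close> by (simp add: add_nonneg_pos)
  qed
  then have "(LINT x|?M. (sine_weight x * q x - h x)\<^sup>2) \<le> (LINT x|?M. \<epsilon> / (?m + 1))"
    by (intro integral_mono int) auto
  also have "\<dots> = ?m / (?m + 1) * \<epsilon>" by simp
  also have "\<dots> < \<epsilon>" using \<open>0 < \<epsilon>\<close> by (simp add: divide_simps add_nonneg_pos)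
  finally show "\<exists>h\<in>sine_polys. integrable ?M (\<lambda>x. (sine_weight x * q x - h x)\<^sup>2) \<and>
      (LINT x|?M. (sine_weight x * q x - h x)\<^sup>2) < \<epsilon>"
    using h(1) int by blast
qed

text \<open>Two dominated limits: first continuous functions approach \<open>w\<close> truncated at
  height \<open>r\<close>, with the constant \<open>r\<close> as bound; then \<open>r\<close> grows,
  with \<open>\<bar>w\<bar>\<close> as bound.\<close>

lemma L2_sine_limit_square_integrable:
  assumes w: "square_integrable (lebesgue_on unit_square) w"
  shows "L2_sine_limit w"
proof -
  let ?M = "lebesgue_on unit_square"
  have lm: "unit_square \<in> sets lebesgue" by (simp add: unit_square_box)
  have wm [measurable]: "w \<in> borel_measurable ?M" and w2: "integrable ?M (\<lambda>x. (w x)\<^sup>2)"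
    using w by (auto simp: square_integrable_def)
  \<comment> \<open>This notion of measurability supplies continuous functions converging to
    \<open>w\<close> almost everywhere.\<close>
  have "w measurable_on unit_square"
    using measurable_on_iff_borel_measurable[OF lm] wm by blast
  then obtain N g where N: "negligible N" and g: "\<And>n. continuous_on UNIV (g n)"
    and gw: "\<And>x. x \<notin> N \<Longrightarrow> (\<lambda>n. g n x) \<longlonglongrightarrow> (if x \<in> unit_square then w x else 0)"
    unfolding measurable_on_def by blast
  have "AE x in lebesgue. x \<notin> N"
    using N by (intro AE_not_in) (simp add: negligible_iff_null_sets)
  then have "AE x in lebesgue. x \<in> unit_square \<longrightarrow> (\<lambda>n. g n x) \<longlonglongrightarrow> w x"
    by eventually_elim (use gw in force)
  then have ae: "AE x in ?M. x \<in> unit_square \<and> (\<lambda>n. g n x) \<longlonglongrightarrow> w x"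
    using lm by (simp add: AE_restrict_space_iff)
  define clamp' where "clamp' r t = max (- r) (min r t)" for r t :: real
  have clamped: "L2_sine_limit (\<lambda>x. clamp' r (w x))" if r: "0 \<le> r" for r
  proof (rule L2_sine_limit_dominated)
    \<comment> \<open>Dividing by the weight cancels it in the limit. The floor
      \<open>1 / real (Suc n)\<close> keeps \<open>q n\<close> continuous up to the boundary, where
      the weight is 0, and disappears in the limit at each interior point.\<close>
    define q where "q n x = clamp' r (g n x) / max (sine_weight x) (1 / real (Suc n))" for n x
    have pos: "0 < max (sine_weight x) (1 / real (Suc n))" for x n
      by (simp add: less_max_iff_disj)
    show "(\<lambda>x. clamp' r (w x)) \<in> borel_measurable ?M" unfolding clamp'_def by measurable
    show "L2_sine_limit (\<lambda>x. sine_weight x * q n x)" for n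
      unfolding q_def clamp'_def
      using pos[of _ n]
      by (intro L2_sine_limit_weight_mult continuous_intros continuous_on_subset[OF g])
         (auto simp: sine_weight_def[abs_def] less_le intro!: continuous_intros)
    show "integrable ?M (\<lambda>x. r\<^sup>2)"
      by (simp add: integrable_unit_square)
    show "AE x in ?M. \<bar>sine_weight x * q n x\<bar> \<le> r" for n
    proof (rule AE_I2)
      fix x assume "x \<in> space ?M"
      then have x: "0 < sine_weight x" by (auto simp: space_restrict_space sine_weight_pos)
      have "\<bar>sine_weight x * q n x\<bar> = (sine_weight x / max (sine_weight x) (1 / real (Suc n))) * \<bar>clamp' r (g n x)\<bar>"
        using x pos[of x n] by (simp add: q_def abs_mult)
      also have "\<dots> \<le> 1 * r"
        using x r pos[of x n] by (intro mult_mono) (auto simp: clamp'_def)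
      finally show "\<bar>sine_weight x * q n x\<bar> \<le> r" by simp
    qed
    show "AE x in ?M. (\<lambda>n. sine_weight x * q n x) \<longlonglongrightarrow> clamp' r (w x)"
      using ae
    proof eventually_elim
      case (elim x)
      then have x: "0 < sine_weight x" by (simp add: sine_weight_pos)
      have "(\<lambda>n. sine_weight x * (clamp' r (g n x) / max (sine_weight x) (1 / real (Suc n)))) \<longlonglongrightarrow>
          sine_weight x * (clamp' r (w x) / max (sine_weight x) 0)"
        unfolding clamp'_def using elim x
        by (intro tendsto_intros LIMSEQ_Suc[OF lim_1_over_n]) auto
      then show ?case using x by (simp add: q_def)
    qed
  qed
  show ?thesis
  proof (rule L2_sine_limit_dominated)
    show "L2_sine_limit (\<lambda>x. clamp' (real n) (w x))" for n by (rule clamped) simp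
    show "integrable ?M (\<lambda>x. \<bar>w x\<bar>\<^sup>2)" using w2 by simp
    show "AE x in ?M. \<bar>clamp' (real n) (w x)\<bar> \<le> \<bar>w x\<bar>" for n
      by (auto simp: clamp'_def)
    show "AE x in ?M. (\<lambda>n. clamp' (real n) (w x)) \<longlonglongrightarrow> w x"
    proof (rule AE_I2)
      fix x
      obtain m where m: "\<bar>w x\<bar> \<le> real m" using real_arch_simple by blast
      show "(\<lambda>n. clamp' (real n) (w x)) \<longlonglongrightarrow> w x"
      proof (rule tendsto_eventually, rule eventually_sequentiallyI)
        fix n assume "m \<le> n"
        then have "\<bar>w x\<bar> \<le> real n" using m by (simp add: order_trans[OF _ of_nat_mono])
        then show "clamp' (real n) (w x) = w x" by (auto simp: clamp'_def)
      qed
    qed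
  qed (rule wm)
qed

section \<open>The Cordes condition\<close>

text \<open>A quadratic form sees only the symmetric part of its matrix, so \<open>b\<close> is the
  mean of the off-diagonal entries. Unit vectors bound the diagonal; one further test vector bounds
  the determinant of the symmetric part.\<close>

lemma loewner_le_mat_2:
  fixes A :: "real^2^2"
  assumes lower: "loewner_le (mat l) A" and upper: "loewner_le A (mat L)" and "0 < l"
  defines "b \<equiv> (A$1$2 + A$2$1) / 2"
  shows "l \<le> A$1$1" "l \<le> A$2$2" "A$1$1 \<le> L" "A$2$2 \<le> L" "l\<^sup>2 \<le> A$1$1 * A$2$2 - b\<^sup>2"
proof -
  have form: "\<xi> \<bullet> (A *v \<xi>) = A$1$1 * (\<xi>$1)\<^sup>2 + 2 * b * \<xi>$1 * \<xi>$2 + A$2$2 * (\<xi>$2)\<^sup>2" for \<xi> :: "real^2"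
    by (simp add: inner_vec_def matrix_vector_mult_def sum_2 b_def power2_eq_square algebra_simps)
  have id: "\<xi> \<bullet> (mat c *v \<xi>) = c * ((\<xi>$1)\<^sup>2 + (\<xi>$2)\<^sup>2)" for c and \<xi> :: "real^2"
    by (simp add: inner_vec_def matrix_vector_mult_def mat_def sum_2 power2_eq_square algebra_simps)
  have lo: "l * (s\<^sup>2 + t\<^sup>2) \<le> A$1$1 * s\<^sup>2 + 2 * b * s * t + A$2$2 * t\<^sup>2"
    and up: "A$1$1 * s\<^sup>2 + 2 * b * s * t + A$2$2 * t\<^sup>2 \<le> L * (s\<^sup>2 + t\<^sup>2)" for s t
    using lower[unfolded loewner_le_def form id, rule_format, of "vector [s, t]"]
      upper[unfolded loewner_le_def form id, rule_format, of "vector [s, t]"] by simp_all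
  show l: "l \<le> A$1$1" "l \<le> A$2$2" "A$1$1 \<le> L" "A$2$2 \<le> L"
    using lo[of 1 0] lo[of 0 1] up[of 1 0] up[of 0 1] by simp_all
  then have pos: "0 < A$1$1" using \<open>0 < l\<close> by simp
  \<comment> \<open>The test vector \<open>(b, - A$1$1)\<close> is orthogonal to the first row of
    the symmetric part, so the form there equals \<open>A$1$1\<close> times the determinant.\<close>
  have "l * (A$1$1)\<^sup>2 \<le> l * (b\<^sup>2 + (A$1$1)\<^sup>2)" using \<open>0 < l\<close> by simp
  also have "\<dots> \<le> A$1$1 * (A$1$1 * A$2$2 - b\<^sup>2)"
    using lo[of b "- A$1$1"] by (simp add: power2_eq_square algebra_simps)
  finally have "A$1$1 * (l * A$1$1) \<le> A$1$1 * (A$1$1 * A$2$2 - b\<^sup>2)"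
    by (simp add: power2_eq_square algebra_simps)
  then have "l * A$1$1 \<le> A$1$1 * A$2$2 - b\<^sup>2" using pos by simp
  moreover have "l\<^sup>2 \<le> l * A$1$1" using l \<open>0 < l\<close> by (simp add: power2_eq_square)
  ultimately show "l\<^sup>2 \<le> A$1$1 * A$2$2 - b\<^sup>2" by simp
qed

text \<open>Here \<open>p\<close>, \<open>r\<close>, \<open>b\<close> describe the Hessian of
  \<open>u\<close> and \<open>x\<close>, \<open>z\<close>, \<open>y\<close> that of
  \<open>v\<close>. With \<open>M\<close> the cofactor matrix and \<open>N\<close> its squared norm,
  Cauchy--Schwarz reduces the claim to the squared norm of \<open>I - \<gamma> M\<close>, which
  equals \<open>1 - 2 * (p * r - b\<^sup>2) / N\<close>. The determinant is at least
  \<open>l\<^sup>2\<close> and \<open>N\<close> is at most \<open>4 * L\<^sup>2\<close>.\<close>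

lemma cordes_condition_2:
  fixes p r b l L :: real
  assumes "0 < l" "l \<le> p" "l \<le> r" "p \<le> L" "r \<le> L" "l\<^sup>2 \<le> p * r - b\<^sup>2"
  defines "\<gamma> \<equiv> (p + r) / (p\<^sup>2 + r\<^sup>2 + 2 * b\<^sup>2)"
  shows "(x + z - \<gamma> * (r * x + p * z - 2 * b * y))\<^sup>2 \<le> (1 - l\<^sup>2 / (2 * L\<^sup>2)) * (x\<^sup>2 + z\<^sup>2 + 2 * y\<^sup>2)"
proof -
  define N where "N = p\<^sup>2 + r\<^sup>2 + 2 * b\<^sup>2"
  have "0 < p" "0 < r" "0 < L" using assms by auto
  then have N: "0 < N" by (simp add: N_def add_pos_nonneg)
  have det: "b\<^sup>2 \<le> p * r" using assms(6) zero_le_power2[of l] by linarith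
  then have "N \<le> (p + r)\<^sup>2" by (simp add: N_def power2_eq_square algebra_simps)
  also have "\<dots> \<le> (2 * L)\<^sup>2" using assms \<open>0 < p\<close> by (intro power_mono) auto
  finally have NL: "N \<le> 4 * L\<^sup>2" by simp
  define \<alpha> \<beta> \<kappa> where "\<alpha> = 1 - \<gamma> * r" and "\<beta> = 1 - \<gamma> * p" and "\<kappa> = \<gamma> * b"
  have "x + z - \<gamma> * (r * x + p * z - 2 * b * y) = \<alpha> * x + \<beta> * z + 2 * (\<kappa> * y)"
    by (simp add: \<alpha>_def \<beta>_def \<kappa>_def algebra_simps)
  \<comment> \<open>Lagrange's identity for the Frobenius product; the factors 2 count each
    off-diagonal entry twice.\<close>
  moreover have "(\<alpha>\<^sup>2 + \<beta>\<^sup>2 + 2 * \<kappa>\<^sup>2) * (x\<^sup>2 + z\<^sup>2 + 2 * y\<^sup>2) - (\<alpha> * x + \<beta> * z + 2 * (\<kappa> * y))\<^sup>2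
      = (\<alpha> * z - \<beta> * x)\<^sup>2 + 2 * (\<alpha> * y - \<kappa> * x)\<^sup>2 + 2 * (\<beta> * y - \<kappa> * z)\<^sup>2"
    by (simp add: power2_eq_square algebra_simps)
  ultimately have cs: "(x + z - \<gamma> * (r * x + p * z - 2 * b * y))\<^sup>2 \<le> (\<alpha>\<^sup>2 + \<beta>\<^sup>2 + 2 * \<kappa>\<^sup>2) * (x\<^sup>2 + z\<^sup>2 + 2 * y\<^sup>2)"
    by (smt (verit) zero_le_power2)
  have \<gamma>: "\<gamma> * N = p + r" using N by (simp add: \<gamma>_def N_def)
  have "\<alpha>\<^sup>2 + \<beta>\<^sup>2 + 2 * \<kappa>\<^sup>2 = 2 - 2 * \<gamma> * (p + r) + \<gamma> * (\<gamma> * N)"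
    by (simp add: \<alpha>_def \<beta>_def \<kappa>_def N_def power2_eq_square algebra_simps)
  also have "\<dots> = 2 - \<gamma> * (p + r)" unfolding \<gamma> by (simp add: algebra_simps)
  also have "\<dots> = 1 - 2 * (p * r - b\<^sup>2) / N"
    using N by (simp add: \<gamma>_def flip: N_def) (simp add: N_def power2_eq_square field_simps)
  also have "\<dots> \<le> 1 - 2 * l\<^sup>2 / (4 * L\<^sup>2)"
    using assms N NL det \<open>0 < L\<close> by (intro diff_mono frac_le) auto
  finally have "\<alpha>\<^sup>2 + \<beta>\<^sup>2 + 2 * \<kappa>\<^sup>2 \<le> 1 - l\<^sup>2 / (2 * L\<^sup>2)" by simp
  then have "(\<alpha>\<^sup>2 + \<beta>\<^sup>2 + 2 * \<kappa>\<^sup>2) * (x\<^sup>2 + z\<^sup>2 + 2 * y\<^sup>2) \<le> (1 - l\<^sup>2 / (2 * L\<^sup>2)) * (x\<^sup>2 + z\<^sup>2 + 2 * y\<^sup>2)"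
    by (intro mult_right_mono) auto
  with cs show ?thesis by simp
qed

section \<open>Vanishing of the residual at a critical point\<close>

theorem mainTheorem6:
  fixes f \<phi> u :: "real^2 \<Rightarrow> real"
  assumes f_L2: "square_integrable (lebesgue_on unit_square) f"
    and f_pos: "AE x in lebesgue_on unit_square. f x > 0"
    and u_C3: "Ck 3 (closure unit_square) u"
    and u_bdry: "\<forall>x\<in>frontier unit_square. u x = \<phi> x"
    and u_convex: "uniformly_convex_on (closure unit_square) u"
    and u_critical: "critical_point f \<phi> u"
  shows "AE x in lebesgue_on unit_square. det (D2 u x) = f x"
proof -
  let ?S = "closure unit_square" and ?M = "lebesgue_on unit_square"
  interpret finite_measure ?M by (rule finite_measure_unit_square)
  have space: "x \<in> ?S" if "x \<in> space ?M" for x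
    using that closure_subset by (auto simp: space_restrict_space)
  have u_C2: "Ck 2 ?S u" using u_critical by (simp add: critical_point_def trial_def)
  note cts = continuous_on_D2[OF u_C2]
  \<comment> \<open>The convexity bounds and the pairing with a symmetric Hessian both see only the
    mean of the off-diagonal entries.\<close>
  define p r b where "p x = D2 u x $ 1 $ 1" and "r x = D2 u x $ 2 $ 2"
    and "b x = (D2 u x $ 1 $ 2 + D2 u x $ 2 $ 1) / 2" for x
  have cprb: "continuous_on ?S p" "continuous_on ?S r" "continuous_on ?S b"
    unfolding p_def r_def b_def by (intro continuous_intros cts; simp)+
  obtain l L where l: "0 < l" "l \<le> L"
    and convex: "\<And>x. x \<in> ?S \<Longrightarrow> loewner_le (mat l) (D2 u x) \<and> loewner_le (D2 u x) (mat L)"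
    using u_convex unfolding uniformly_convex_on_def by blast
  have bounds: "l \<le> p x" "l \<le> r x" "p x \<le> L" "r x \<le> L" "l\<^sup>2 \<le> p x * r x - (b x)\<^sup>2" if "x \<in> ?S" for x
    using loewner_le_mat_2[of l "D2 u x" L] convex[OF that] l by (simp_all add: p_def r_def b_def)
  define \<epsilon> where "\<epsilon> = l\<^sup>2 / (2 * L\<^sup>2)"
  have \<epsilon>: "0 < \<epsilon>" using l by (simp add: \<epsilon>_def)
  define \<gamma> where "\<gamma> x = (p x + r x) / ((p x)\<^sup>2 + (r x)\<^sup>2 + 2 * (b x)\<^sup>2)" for x
  have \<gamma>_pos: "0 < \<gamma> x" if "x \<in> ?S" for x
    unfolding \<gamma>_def using bounds[OF that] l by (intro divide_pos_pos add_pos_nonneg) auto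
  \<comment> \<open>Continuity on the closed square makes \<open>1 / \<gamma>\<close> bounded, so
    \<open>w\<close> below inherits square integrability from \<open>g\<close>.\<close>
  have c\<gamma>: "continuous_on ?S (\<lambda>x. 1 / \<gamma> x)"
  proof -
    have "p x + r x \<noteq> 0" if "x \<in> ?S" for x using bounds[OF that] l by linarith
    then have "continuous_on ?S (\<lambda>x. ((p x)\<^sup>2 + (r x)\<^sup>2 + 2 * (b x)\<^sup>2) / (p x + r x))"
      by (intro continuous_intros cprb) auto
    then show ?thesis by (simp add: \<gamma>_def)
  qed
  define d where "d x = det (D2 u x)" for x
  have cd: "continuous_on ?S d"
    unfolding d_def det_2 by (intro continuous_intros cts)
  have fi: "integrable ?M f" and f2: "integrable ?M (\<lambda>x. (f x)\<^sup>2)"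
    using f_L2 square_integrable_imp_integrable by (auto simp: square_integrable_def)
  define g where "g x = d x - f x" for x
  have gi: "integrable ?M g" unfolding g_def using integrable_unit_square[OF cd] fi by simp
  have g2: "integrable ?M (\<lambda>x. (g x)\<^sup>2)"
  proof -
    have "(\<lambda>x. (g x)\<^sup>2) = (\<lambda>x. (d x)\<^sup>2 - 2 * (f x * d x) + (f x)\<^sup>2)"
      by (auto simp: g_def power2_eq_square algebra_simps)
    moreover have "integrable ?M (\<lambda>x. (d x)\<^sup>2)" by (intro integrable_unit_square continuous_intros cd)
    ultimately show ?thesis using bounded_integrable[OF cd fi] f2 by simp
  qed
  define w where "w x = g x * (1 / \<gamma> x)" for x
  have wi: "integrable ?M w" unfolding w_def by (rule bounded_integrable[OF c\<gamma> gi])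
  then have wm [measurable]: "w \<in> borel_measurable ?M" by simp
  have w2: "integrable ?M (\<lambda>x. (w x)\<^sup>2)"
    unfolding w_def power_mult_distrib
    by (rule bounded_integrable[OF _ g2]) (intro continuous_intros c\<gamma>)
  \<comment> \<open>The Laplacian \<open>h\<close> of \<open>v\<close> differs from
    \<open>\<gamma> x * Lv x\<close> by an error that Cordes bounds by the Hessian of
    \<open>v\<close>. After integration criticality removes \<open>g x * Lv x\<close>, and the
    energy identity turns the Hessian term into \<open>1 - \<epsilon>\<close> times the integral of
    \<open>(h x)\<^sup>2\<close>.\<close>
  have key: "\<epsilon> * (LINT x|?M. (h x)\<^sup>2) \<le> (LINT x|?M. (w x - h x)\<^sup>2)"
    if h: "h \<in> sine_polys" and wh: "integrable ?M (\<lambda>x. (w x - h x)\<^sup>2)" for h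
  proof -
    obtain c K where h_eq: "h = trig_sum sin sin c K" using h by (auto simp: sine_polys_def)
    obtain v where v: "Ck 2 ?S v" "\<And>x. x \<in> frontier unit_square \<Longrightarrow> v x = 0"
      and lap: "\<And>x. x \<in> ?S \<Longrightarrow> D2 v x $ 1 $ 1 + D2 v x $ 2 $ 2 = h x"
      and sym: "\<And>x. x \<in> ?S \<Longrightarrow> D2 v x $ 1 $ 2 = D2 v x $ 2 $ 1"
      and energy: "(LINT x|?M. D2 v x \<bullet> D2 v x) = (LINT x|?M. (h x)\<^sup>2)"
      by (rule inverse_laplacian_trig_sum[of c K, folded h_eq], rule that)
    define Lv where "Lv x = cofactor_matrix (D2 u x) \<bullet> D2 v x" for x
    have cLv: "continuous_on ?S Lv" and cV: "continuous_on ?S (\<lambda>x. D2 v x \<bullet> D2 v x)"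
      unfolding Lv_def frobenius cofactor_matrix_def sum_2 vector_2
      by (intro continuous_intros cts continuous_on_D2[OF v(1)])+
    have int: "integrable ?M (\<lambda>x. g x * Lv x)" "integrable ?M (\<lambda>x. D2 v x \<bullet> D2 v x)"
      "integrable ?M (\<lambda>x. (h x)\<^sup>2)"
      by (intro bounded_integrable integrable_unit_square cLv cV gi continuous_intros sine_polys_continuous h)+
    have "(LINT x|?M. g x * Lv x) = 0"
      using u_critical v unfolding critical_point_def DJ_def g_def d_def Lv_def by blast
    then have "(LINT x|?M. (h x)\<^sup>2 - (1 - \<epsilon>) * (D2 v x \<bullet> D2 v x) - 2 * (g x * Lv x)) =
        (LINT x|?M. (h x)\<^sup>2) - (1 - \<epsilon>) * (LINT x|?M. (h x)\<^sup>2)"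
      using int energy by simp
    then have "\<epsilon> * (LINT x|?M. (h x)\<^sup>2) =
        (LINT x|?M. (h x)\<^sup>2 - (1 - \<epsilon>) * (D2 v x \<bullet> D2 v x) - 2 * (g x * Lv x))"
      by (simp add: left_diff_distrib)
    also have "\<dots> \<le> (LINT x|?M. (w x - h x)\<^sup>2)"
    proof (rule integral_mono[OF _ wh])
      show "integrable ?M (\<lambda>x. (h x)\<^sup>2 - (1 - \<epsilon>) * (D2 v x \<bullet> D2 v x) - 2 * (g x * Lv x))"
        using int by simp
      fix x assume "x \<in> space ?M"
      then have x: "x \<in> ?S" by (rule space)
      have "Lv x = r x * D2 v x $ 1 $ 1 + p x * D2 v x $ 2 $ 2 - 2 * b x * D2 v x $ 1 $ 2"
        using sym[OF x] by (simp add: Lv_def frobenius cofactor_matrix_def sum_2 p_def r_def b_def algebra_simps)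
      moreover have "D2 v x \<bullet> D2 v x = (D2 v x $ 1 $ 1)\<^sup>2 + (D2 v x $ 2 $ 2)\<^sup>2 + 2 * (D2 v x $ 1 $ 2)\<^sup>2"
        using sym[OF x] by (simp add: frobenius sum_2 power2_eq_square)
      ultimately have cordes: "(h x - \<gamma> x * Lv x)\<^sup>2 \<le> (1 - \<epsilon>) * (D2 v x \<bullet> D2 v x)"
        using cordes_condition_2[OF l(1) bounds[OF x], of "D2 v x $ 1 $ 1" "D2 v x $ 2 $ 2" "D2 v x $ 1 $ 2"]
        by (simp add: lap[OF x] \<epsilon>_def \<gamma>_def)
      have "g x = w x * \<gamma> x" using \<gamma>_pos[OF x] by (simp add: w_def)
      \<comment> \<open>This completes a square whose cross term is exactly
        \<open>g x * Lv x\<close>, because \<open>w x * \<gamma> x = g x\<close>; the first square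
        is then dropped.\<close>
      then have "(w x - h x)\<^sup>2 = (w x - (h x - \<gamma> x * Lv x))\<^sup>2 - (h x - \<gamma> x * Lv x)\<^sup>2 - 2 * (g x * Lv x) + (h x)\<^sup>2"
        by (simp add: power2_eq_square algebra_simps)
      then show "(h x)\<^sup>2 - (1 - \<epsilon>) * (D2 v x \<bullet> D2 v x) - 2 * (g x * Lv x) \<le> (w x - h x)\<^sup>2"
        using cordes zero_le_power2[of "w x - (h x - \<gamma> x * Lv x)"] by linarith
    qed
    finally show ?thesis .
  qed
  have small: "(LINT x|?M. (w x)\<^sup>2) \<le> \<delta>" if "0 < \<delta>" for \<delta>
  proof -
    \<comment> \<open>The choice makes \<open>2 * \<delta>' + 2 * \<delta>' / \<epsilon>\<close>
      equal to \<open>\<delta>\<close>: the first term bounds the approximation error, the second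
      the sine sum itself through \<open>key\<close>.\<close>
    define \<delta>' where "\<delta>' = \<delta> / (2 + 2 / \<epsilon>)"
    have "0 < 2 + 2 / \<epsilon>" using \<epsilon> by (simp add: add_pos_pos)
    then have "0 < \<delta>'" and \<delta>: "\<delta> = (2 + 2 / \<epsilon>) * \<delta>'" using that by (simp_all add: \<delta>'_def)
    then obtain h where h: "h \<in> sine_polys" and int: "integrable ?M (\<lambda>x. (w x - h x)\<^sup>2)"
      and le: "(LINT x|?M. (w x - h x)\<^sup>2) < \<delta>'"
      using L2_sine_limit_square_integrable[of w] wm w2 by (auto simp: square_integrable_def L2_sine_limit_def)
    have int_h: "integrable ?M (\<lambda>x. (h x)\<^sup>2)"
      by (intro integrable_unit_square continuous_intros sine_polys_continuous h)
    have "(LINT x|?M. (w x)\<^sup>2) \<le> (LINT x|?M. 2 * (w x - h x)\<^sup>2 + 2 * (h x)\<^sup>2)"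
    proof (rule integral_mono[OF w2])
      show "(w x)\<^sup>2 \<le> 2 * (w x - h x)\<^sup>2 + 2 * (h x)\<^sup>2" for x
        using zero_le_power2[of "w x - 2 * h x"] by (simp add: power2_eq_square algebra_simps)
    qed (use int int_h in simp)
    also have "\<dots> = 2 * (LINT x|?M. (w x - h x)\<^sup>2) + 2 * (LINT x|?M. (h x)\<^sup>2)"
      using int int_h by simp
    also have "(LINT x|?M. (h x)\<^sup>2) \<le> \<delta>' / \<epsilon>"
      using key[OF h int] le \<epsilon> by (simp add: pos_le_divide_eq mult.commute)
    finally show ?thesis using le by (simp add: \<delta> algebra_simps)
  qed
  have "(LINT x|?M. (w x)\<^sup>2) = 0"
  proof (rule antisym)
    show "(LINT x|?M. (w x)\<^sup>2) \<le> 0" by (rule field_le_epsilon) (simp add: small)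
  qed simp
  then have "AE x in ?M. (w x)\<^sup>2 = 0"
    using integral_nonneg_eq_0_iff_AE[OF w2] by simp
  with AE_space show ?thesis
  proof eventually_elim
    case (elim x)
    then have "0 < \<gamma> x" using space \<gamma>_pos by blast
    with elim show ?case by (simp add: w_def g_def d_def)
  qed
qed

end
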